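(* Let $L$ be a flat virtual link such that, for every pair of distinct components $A,B$, the number of $+$ ends of $AB$-crossings on $A$ equals the number of $-$ ends of $AB$-crossings on $A$. Then the polynomial $p_L$ is an invariant of the flat virtual link $L$; that is, $p_L$ does not depend on the chosen partitions $\mathcal P(A,B)$ of the $AB$-crossings, and it is unchanged when the Gauss code representing $L$ is replaced by another one obtained from it by a finite sequence of flat Reidemeister moves (the variables $t_A$ and $t_{A,B}$ being matched via the correspondence of components under the moves).
   Context: Gauss codes. A flat virtual link is represented by a Gauss code: a finite set of crossings together with a finite collection of cyclic words (codewords), one for each (oriented) component, in the signed letters $x^+,x^-$ ($x$ a crossing), such that for each crossing $x$ each of the two letters $x^+$ and $x^-$ occurs exactly once in total over all codewords. (Geometrically: in a planar diagram of oriented curves, each non-virtual crossing $x$ gives $x^-$ on the strand for which the other strand crosses from left to right, and $x^+$ on the strand for which the other strand crosses from right to left; virtual crossings are not recorded.) A component and its codeword are denoted by the same symbol $A$. Flat Reidemeister moves. Two Gauss codes represent the same flat virtual link if and only if they are related (up to relabelling of crossings) by a finite sequence of the following moves and their inverses. Moves involving virtual crossings do not change the Gauss code. Type I: delete a crossing $e$ for which $e^+$ and $e^-$ occur consecutively (in either order) in a codeword. Type II: delete two distinct crossings $e,f$ for which, for some sign $\epsilon$, $e^{\epsilon}f^{-\epsilon}$ occur consecutively in this order in some codeword, and $e^{-\epsilon},f^{\epsilon}$ occur consecutively (in either order) in some (possibly the same) codeword. Type III: if there are three distinct crossings $1,2,3$ such that $1^+3^-$, $2^+1^-$ and $3^+2^-$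 each occur consecutively in the given order in codewords (not necessarily distinct), replace these by $3^-1^+$, $1^-2^+$ and $2^-3^+$ respectively. (This is the cyclic triangle version; the other oriented versions of the third move are consequences of it and the Type II moves.) Notation. For distinct letters $x^\epsilon,y^\delta$ of the same codeword $A$, $\eta_A(x^\epsilon,y^\delta)$ is the number of $+$ letters minus the number of $-$ letters encountered as one cycles forward through $A$ from $x^\epsilon$ to $y^\delta$, not including these two letters. $\mathcal K(A)$ is the set of self-crossings of $A$, i.e. crossings $x$ with both $x^+$ and $x^-$ in $A$. For distinct components $A,B$, an $AB$-crossing is a crossing with one of its two letters in $A$ and the other in $B$. By the assumption on equal numbers of $+$ and $-$ ends, the $AB$-crossings can be partitioned (arbitrarily) into pairs $\{x,y\}$ such that $x^+$ and $y^-$ are in the same one of $A$ and $B$; $\mathcal P(A,B)$ denotes the set of pairs in a chosen such partition. The polynomial. With one variable $t_A$ for each component $A$ and one variable $t_{A,B}$ for each unordered pair of distinct components, set $$p_A(t_A)=\sum_{x\in\mathcal K(A)}\eta_A(x^+,x^-)\,t_A^{|\eta_A(x^+,x^-)|},$$ $$p_{A,B}(t_{A,B})=t_{A,B}\sum_{\{x,y\}\in\mathcal P(A,B)}\left(\eta_A(x^+,y^-)+\eta_B(y^+,x^-)\right),$$ where in the second sum the labelling of each pair is chosen so that $x^+,y^-$ are in $A$ and $x^-,y^+$ are in $B$. Then $$p_L=\sum_{A}p_A(t_A)+\sum_{\{A,B\}}p_{A,B}(t_{A,B}),$$ the sums being over all components $A$ and all unordered pairs of distinct components $\{A,B\}$.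 *)

theory Defs
  imports
    "HOL-Library.Poly_Mapping"
    "HOL-Library.Disjoint_Sets"
    "HOL-Combinatorics.Transposition"
begin

section \<open>Gauss codes\<close>

text \<open>
  The letter \<open>x\<^sup>+\<close> is \<open>(x, True)\<close> and the letter \<open>x\<^sup>-\<close> is \<open>(x, False)\<close>.
  A cyclic word is represented by a list, which is to be read up to rotation. The components of a
  link are the positions \<open>0, \<dots>, length L - 1\<close> of the list of its codewords. All moves keep these
  positions, so that they give the correspondence of components. Codewords may be empty.
\<close>

type_synonym 'x letter = "'x \<times> bool"
type_synonym 'x word = "'x letter list"
type_synonym 'x gauss_code = "'x word list"

definition letters :: "'x gauss_code \<Rightarrow> 'x letter set" where
  "letters L = set (concat L)"

definition crossings :: "'x gauss_code \<Rightarrow> 'x set" where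
  "crossings L = fst ` letters L"

definition is_gauss_code :: "'x gauss_code \<Rightarrow> bool" where
  "is_gauss_code L \<longleftrightarrow>
     distinct (concat L) \<and> (\<forall>x\<in>crossings L. \<forall>s. (x, s) \<in> letters L)"

section \<open>Flat Reidemeister moves\<close>

definition consecutive :: "'x gauss_code \<Rightarrow> 'x letter \<Rightarrow> 'x letter \<Rightarrow> bool" where
  "consecutive L a b \<longleftrightarrow> (\<exists>w\<in>set L. \<exists>n v. rotate n w = a # b # v)"

definition delete_crossings :: "'x set \<Rightarrow> 'x gauss_code \<Rightarrow> 'x gauss_code" where
  "delete_crossings E L = map (filter (\<lambda>a. fst a \<notin> E)) L"

text \<open>
  Every letter occurs only once in a Gauss code, so exchanging two letters \<open>a\<close>, \<open>b\<close> throughout the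
  code replaces consecutive letters \<open>a b\<close> by \<open>b a\<close> (also across the end of a list) and changes
  nothing else.
\<close>

definition swap_letters :: "'x letter \<Rightarrow> 'x letter \<Rightarrow> 'x gauss_code \<Rightarrow> 'x gauss_code" where
  "swap_letters a b L = map (map (Transposition.transpose a b)) L"

inductive flat_move :: "'x gauss_code \<Rightarrow> 'x gauss_code \<Rightarrow> bool" where
  rotation:
    "is_gauss_code L \<Longrightarrow> list_all2 (\<lambda>w w'. \<exists>n. w' = rotate n w) L L' \<Longrightarrow> flat_move L L'"
| relabelling:
    "is_gauss_code L \<Longrightarrow> inj_on f (crossings L) \<Longrightarrow> flat_move L (map (map (apfst f)) L)"
| type_I:
    "is_gauss_code L \<Longrightarrow> consecutive L (e, s) (e, \<not> s) \<Longrightarrow>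
     flat_move L (delete_crossings {e} L)"
| type_II:
    "is_gauss_code L \<Longrightarrow> e \<noteq> f \<Longrightarrow>
     consecutive L (e, s) (f, \<not> s) \<Longrightarrow>
     consecutive L (e, \<not> s) (f, s) \<or> consecutive L (f, s) (e, \<not> s) \<Longrightarrow>
     flat_move L (delete_crossings {e, f} L)"
| type_III:
    "is_gauss_code L \<Longrightarrow> distinct [x, y, z] \<Longrightarrow>
     consecutive L (x, True) (z, False) \<Longrightarrow>
     consecutive L (y, True) (x, False) \<Longrightarrow>
     consecutive L (z, True) (y, False) \<Longrightarrow>
     flat_move L
       (swap_letters (x, True) (z, False)
         (swap_letters (y, True) (x, False)
           (swap_letters (z, True) (y, False) L)))"

definition flat_equivalent :: "'x gauss_code \<Rightarrow> 'x gauss_code \<Rightarrow> bool" where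
  "flat_equivalent = equivclp flat_move"

section \<open>Crossings between components\<close>

text \<open>
  \<open>eta w a b\<close> counts the letters strictly between \<open>a\<close> and \<open>b\<close> on the way forward from \<open>a\<close> to \<open>b\<close>.
  The word is doubled to allow for passing its end.
\<close>

definition eta :: "'x word \<Rightarrow> 'x letter \<Rightarrow> 'x letter \<Rightarrow> int" where
  "eta w a b =
     (\<Sum>c\<leftarrow>takeWhile (\<lambda>c. c \<noteq> b) (tl (dropWhile (\<lambda>c. c \<noteq> a) (w @ w))). if snd c then 1 else - 1)"

definition self_crossings :: "'x word \<Rightarrow> 'x set" where
  "self_crossings w = {x. (x, True) \<in> set w \<and> (x, False) \<in> set w}"

definition mixed_crossings :: "'x word \<Rightarrow> 'x word \<Rightarrow> 'x set" where
  "mixed_crossings v w = {x. \<exists>s. (x, s) \<in> set v \<and> (x, \<not> s) \<in> set w}"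

definition balanced :: "'x gauss_code \<Rightarrow> bool" where
  "balanced L \<longleftrightarrow>
     (\<forall>A<length L. \<forall>B<length L. A \<noteq> B \<longrightarrow>
        card {x \<in> mixed_crossings (L ! A) (L ! B). (x, True) \<in> set (L ! A)} =
        card {x \<in> mixed_crossings (L ! A) (L ! B). (x, False) \<in> set (L ! A)})"

definition is_pairing :: "'x word \<Rightarrow> 'x word \<Rightarrow> 'x set set \<Rightarrow> bool" where
  "is_pairing v w P \<longleftrightarrow>
     partition_on (mixed_crossings v w) P \<and>
     (\<forall>p\<in>P. \<exists>x y. p = {x, y} \<and> x \<noteq> y \<and>
        ((x, True) \<in> set v \<and> (y, False) \<in> set v \<or> (x, True) \<in> set w \<and> (y, False) \<in> set w))"

text \<open>An unordered pair of distinct components is represented by its indices \<open>A < B\<close>.\<close>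

definition pairing_choice :: "'x gauss_code \<Rightarrow> (nat \<Rightarrow> nat \<Rightarrow> 'x set set) \<Rightarrow> bool" where
  "pairing_choice L P \<longleftrightarrow>
     (\<forall>A B. A < B \<and> B < length L \<longrightarrow> is_pairing (L ! A) (L ! B) (P A B))"

section \<open>The polynomial\<close>

text \<open>\<open>Self_Var A\<close> is \<open>t\<^sub>A\<close> and \<open>Pair_Var {A, B}\<close> is \<open>t\<^sub>A\<^sub>,\<^sub>B\<close>.\<close>

datatype link_var = Self_Var nat | Pair_Var "nat set"

type_synonym link_polynomial = "(link_var \<Rightarrow>\<^sub>0 nat) \<Rightarrow>\<^sub>0 int"

definition indet :: "link_var \<Rightarrow> link_polynomial" where
  "indet v = Poly_Mapping.single (Poly_Mapping.single v 1) 1"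

definition self_poly :: "'x gauss_code \<Rightarrow> nat \<Rightarrow> link_polynomial" where
  "self_poly L A =
     (\<Sum>x\<in>self_crossings (L ! A).
        of_int (eta (L ! A) (x, True) (x, False)) *
        indet (Self_Var A) ^ nat \<bar>eta (L ! A) (x, True) (x, False)\<bar>)"

text \<open>
  Each pair in \<open>P\<close> contributes exactly one summand, namely for the labelling \<open>(x, y)\<close> of its elements
  with \<open>x\<^sup>+\<close>, \<open>y\<^sup>-\<close> in \<open>A\<close> and \<open>x\<^sup>-\<close>, \<open>y\<^sup>+\<close> in \<open>B\<close>.
\<close>

definition pair_poly :: "'x gauss_code \<Rightarrow> nat \<Rightarrow> nat \<Rightarrow> 'x set set \<Rightarrow> link_polynomial" where
  "pair_poly L A B P =
     indet (Pair_Var {A, B}) *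
     of_int (\<Sum>(x, y) \<in> {(x, y). {x, y} \<in> P \<and>
                (x, True) \<in> set (L ! A) \<and> (y, False) \<in> set (L ! A) \<and>
                (x, False) \<in> set (L ! B) \<and> (y, True) \<in> set (L ! B)}.
        eta (L ! A) (x, True) (y, False) + eta (L ! B) (y, True) (x, False))"

definition link_poly :: "'x gauss_code \<Rightarrow> (nat \<Rightarrow> nat \<Rightarrow> 'x set set) \<Rightarrow> link_polynomial" where
  "link_poly L P =
     (\<Sum>A<length L. self_poly L A) +
     (\<Sum>(A, B) \<in> {(A, B). A < B \<and> B < length L}. pair_poly L A B (P A B))"

end

theory Submission
  imports Defs "HOL-Library.Multiset"
begin

text \<open>
  The balance hypothesis forces the signs of every codeword to add up to zero: the two ends of a
  self-crossing cancel each other, and the ends of the crossings with any one other component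
  cancel in total. So the partial sums of the signs define a height on the letters of each cyclic
  word, up to an additive constant for each word. Normalised as the larger of the two partial sums
  next to a letter, the height \<open>H\<close> satisfies \<open>\<eta>\<^sub>A(x\<^sup>+, y\<^sup>-) = H(y\<^sup>-) - H(x\<^sup>+)\<close> (lemma
  \<open>eta_eq_height_difference\<close>).

  Give each crossing the index \<open>H(x\<^sup>-) - H(x\<^sup>+)\<close>. The coefficient of a self-crossing is its
  index, and the summand of a pair \<open>{x, y}\<close> of \<open>AB\<close>-crossings is, after regrouping its four heights,
  the sum of the indices of \<open>x\<close> and \<open>y\<close>. Hence the polynomial is a sum over single crossings in
  which the pairing does not appear (lemma \<open>link_poly_eq_height_poly\<close>). This settles the
  independence of the pairing. It also shows that the choice of \<open>H\<close> does not matter, because a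
  balanced code has a pairing (lemma \<open>ex_pairing_choice\<close>).

  Each move can now be followed on a single height function. A \<open>+\<close> letter and a \<open>-\<close> letter next to
  each other have equal heights, and deleting them changes no other height. So the crossing of a
  type I move has index \<open>0\<close>, and the two crossings of a type II move, which join the same
  components, have opposite indices; as the contribution of a crossing is an odd function of its
  index, nothing is lost. In a type III move each of the three consecutive pairs changes from
  \<open>+ -\<close> to \<open>- +\<close>, a peak becoming a valley. All six letters drop by \<open>1\<close>, so that no index changes.
\<close>

section \<open>Words and heights\<close>

definition charge :: "'x word \<Rightarrow> int" where
  "charge w = (\<Sum>c\<leftarrow>w. if snd c then 1 else - 1)"

lemma charge_simps [simp]:
  "charge [] = 0"
  "charge (a # w) = (if snd a then 1 else - 1) + charge w"
  "charge (u @ v) = charge u + charge v"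
  by (simp_all add: charge_def)

text \<open>
  The height of a letter is the larger of the partial sums of signs just before and just after it,
  where the partial sums start at \<open>c\<close>.
\<close>

primrec heights_from :: "('x letter \<Rightarrow> int) \<Rightarrow> int \<Rightarrow> 'x word \<Rightarrow> bool" where
  "heights_from H c [] \<longleftrightarrow> True"
| "heights_from H c (a # w) \<longleftrightarrow>
     H a = c + of_bool (snd a) \<and> heights_from H (c + (if snd a then 1 else - 1)) w"

text \<open>
  A vanishing total sign is what makes the heights well defined on the cyclic word, and the
  unspecified starting value makes the notion independent of the rotation.
\<close>

definition word_height :: "('x letter \<Rightarrow> int) \<Rightarrow> 'x word \<Rightarrow> bool" where
  "word_height H w \<longleftrightarrow> charge w = 0 \<and> (\<exists>c. heights_from H c w)"

definition is_height :: "'x gauss_code \<Rightarrow> ('x letter \<Rightarrow> int) \<Rightarrow> bool" where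
  "is_height L H \<longleftrightarrow> (\<forall>w\<in>set L. word_height H w)"

lemma heights_from_append [simp]:
  "heights_from H c (u @ v) \<longleftrightarrow> heights_from H c u \<and> heights_from H (c + charge u) v"
  by (induction u arbitrary: c) (auto simp: algebra_simps)

lemma heights_from_cong:
  "(\<And>a. a \<in> set w \<Longrightarrow> H a = H' a) \<Longrightarrow> heights_from H c w \<longleftrightarrow> heights_from H' c w"
  by (induction w arbitrary: c) auto

lemma heights_from_map_apfst:
  "heights_from H c (map (apfst f) w) \<longleftrightarrow> heights_from (H \<circ> apfst f) c w"
  by (induction w arbitrary: c) auto

lemma charge_map_apfst: "charge (map (apfst f) w) = charge w"
  by (simp add: charge_def comp_def)

lemma word_height_cong:
  "(\<And>a. a \<in> set w \<Longrightarrow> H a = H' a) \<Longrightarrow> word_height H w \<longleftrightarrow> word_height H' w"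
  unfolding word_height_def using heights_from_cong by blast

text \<open>
  If the total sign is zero, going through \<open>v\<close> first means starting at the value reached after
  \<open>u\<close>, and one comes back to the original starting value after \<open>v\<close>.
\<close>

lemma word_height_append_swap: "word_height H (u @ v) \<Longrightarrow> word_height H (v @ u)"
  unfolding word_height_def by (auto simp: add.assoc add.commute[of "charge v"])

lemma word_height_rotate [simp]: "word_height H (rotate n w) \<longleftrightarrow> word_height H w"
  using word_height_append_swap[of H "drop (n mod length w) w" "take (n mod length w) w"]
    word_height_append_swap[of H "take (n mod length w) w" "drop (n mod length w) w"]
  by (auto simp: rotate_drop_take)

lemma filter_rotate: "\<exists>m. filter P (rotate n w) = rotate m (filter P w)"
proof -
  let ?k = "n mod length w"
  have "filter P (rotate n w) = filter P (drop ?k w) @ filter P (take ?k w)"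
    by (simp add: rotate_drop_take)
  also have "\<dots> = rotate (length (filter P (take ?k w))) (filter P (take ?k w) @ filter P (drop ?k w))"
    by (simp add: rotate_append)
  also have "filter P (take ?k w) @ filter P (drop ?k w) = filter P w"
    by (metis append_take_drop_id filter_append)
  finally show ?thesis by blast
qed

lemma ex_heights_from: "distinct w \<Longrightarrow> \<exists>H. heights_from H c w"
proof (induction w arbitrary: c)
  case Nil
  then show ?case by simp
next
  case (Cons a w)
  let ?c = "c + (if snd a then 1 else - 1)"
  from Cons obtain H where H: "heights_from H ?c w" by fastforce
  have "heights_from (H(a := c + of_bool (snd a))) ?c w"
    using H Cons.prems by (subst heights_from_cong[of w _ H]) auto
  then show ?case by (intro exI[of _ "H(a := c + of_bool (snd a))"]) (simp del: fun_upd_apply, simp)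
qed

lemma heights_from_concat:
  "heights_from H c (concat L) \<Longrightarrow> w \<in> set L \<Longrightarrow> \<exists>c'. heights_from H c' w"
  by (induction L arbitrary: c) auto

text \<open>
  The signs strictly between \<open>a\<close> and \<open>b\<close> add up to the difference of the partial sums before
  \<open>b\<close> and after \<open>a\<close>; the indicators translate these partial sums into heights. If \<open>b\<close> comes first
  in the list, the way from \<open>a\<close> to \<open>b\<close> passes the end of the list, where nothing jumps because
  the total sign is zero.
\<close>

lemma eta_eq_height_difference:
  assumes H: "word_height H w" and "distinct w" and "a \<in> set w" and "b \<in> set w" and "a \<noteq> b"
  shows "eta w a b = H b - H a + 1 - of_bool (snd a) - of_bool (snd b)"
proof -
  obtain u v where w: "w = u @ a # v" using \<open>a \<in> set w\<close> by (auto dest: split_list)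
  have au: "a \<notin> set u" and av: "a \<notin> set v" using \<open>distinct w\<close> w by auto
  have drop: "tl (dropWhile (\<lambda>c. c \<noteq> a) (w @ w)) = v @ w"
    by (subst w) (use au in \<open>simp add: dropWhile_append2 dropWhile_append split: if_splits\<close>)
  have eta: "eta w a b = charge (takeWhile (\<lambda>c. c \<noteq> b) (v @ w))"
    by (simp add: eta_def charge_def drop)
  obtain c where c: "heights_from H c w" and 0: "charge w = 0"
    using H by (auto simp: word_height_def)
  consider "b \<in> set v" | "b \<in> set u" using \<open>b \<in> set w\<close> \<open>a \<noteq> b\<close> w by auto
  then show ?thesis
  proof cases
    case 1
    then obtain m v' where v: "v = m @ b # v'" by (auto dest: split_list)
    have "b \<notin> set m" using \<open>distinct w\<close> w v by auto
    then have "takeWhile (\<lambda>c. c \<noteq> b) (v @ w) = m"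
      unfolding v by (subst append_assoc, subst takeWhile_append2) auto
    then show ?thesis using eta c unfolding w v by (auto split: if_splits)
  next
    case 2
    then obtain u' m where u: "u = u' @ b # m" by (auto dest: split_list)
    have "b \<notin> set u'" "b \<notin> set v" using \<open>distinct w\<close> w u by auto
    then have "takeWhile (\<lambda>c. c \<noteq> b) (v @ w) = v @ u'"
      unfolding w u append_assoc append_Cons by (simp add: takeWhile_append takeWhile_eq_all_conv)
    then show ?thesis using eta c 0 unfolding w u by (auto split: if_splits)
  qed
qed

section \<open>Letters and crossings of a Gauss code\<close>

lemma letter_in_unique_word:
  "distinct (concat L) \<Longrightarrow> w \<in> set L \<Longrightarrow> w' \<in> set L \<Longrightarrow> a \<in> set w \<Longrightarrow> a \<in> set w' \<Longrightarrow> w = w'"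
  by (auto simp: distinct_concat_iff)

lemma letter_in_unique_component:
  "distinct (concat L) \<Longrightarrow> i < length L \<Longrightarrow> j < length L \<Longrightarrow> a \<in> set (L ! i) \<Longrightarrow> a \<in> set (L ! j) \<Longrightarrow>
   i = j"
proof (induction L arbitrary: i j)
  case (Cons w L)
  then show ?case
    by (cases i; cases j) (auto, (metis UN_I disjoint_iff nth_mem)+)
qed simp

lemma distinct_word: "distinct (concat L) \<Longrightarrow> w \<in> set L \<Longrightarrow> distinct w"
  by (auto simp: distinct_concat_iff)

lemma gauss_code_distinct: "is_gauss_code L \<Longrightarrow> distinct (concat L)"
  by (simp add: is_gauss_code_def)

lemma finite_mixed_crossings [simp]: "finite (mixed_crossings v w)"
proof (rule finite_subset)
  show "mixed_crossings v w \<subseteq> fst ` set v" by (force simp: mixed_crossings_def)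
qed simp

lemma self_crossings_eq_mixed: "self_crossings w = mixed_crossings w w"
  unfolding self_crossings_def mixed_crossings_def by (auto simp: ex_bool_eq)

text \<open>
  The components of its two ends determine for which pairs of components a crossing counts. The
  case \<open>i = j\<close> is that of self-crossings.
\<close>

lemma mixed_crossings_iff_components:
  assumes "is_gauss_code L" and "i < length L" and "j < length L" and "A < length L" and "B < length L"
    and "(x, s) \<in> set (L ! i)" and "(x, \<not> s) \<in> set (L ! j)"
  shows "x \<in> mixed_crossings (L ! A) (L ! B) \<longleftrightarrow> A = i \<and> B = j \<or> A = j \<and> B = i"
proof
  assume "x \<in> mixed_crossings (L ! A) (L ! B)"
  then obtain t where "(x, t) \<in> set (L ! A)" "(x, \<not> t) \<in> set (L ! B)"
    by (auto simp: mixed_crossings_def)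
  moreover have "t = s \<or> t = (\<not> s)" by auto
  ultimately show "A = i \<and> B = j \<or> A = j \<and> B = i"
    using assms(2-) letter_in_unique_component[OF gauss_code_distinct[OF assms(1)]] by auto
qed (use assms in \<open>auto simp: mixed_crossings_def intro: exI[of _ "\<not> s"]\<close>)

definition sign_on :: "'x word \<Rightarrow> 'x \<Rightarrow> int" where
  "sign_on w x = (if (x, True) \<in> set w then 1 else - 1)"

lemma mixed_crossing_one_end:
  assumes "is_gauss_code L" and "A < length L" and "B < length L" and "A \<noteq> B"
    and "x \<in> mixed_crossings (L ! A) (L ! B)"
  shows "(x, s) \<in> set (L ! A) \<longleftrightarrow> (x, \<not> s) \<in> set (L ! B)"
    and "(x, s) \<in> set (L ! A) \<longleftrightarrow> (x, \<not> s) \<notin> set (L ! A)"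
proof -
  obtain t where t: "(x, t) \<in> set (L ! A)" "(x, \<not> t) \<in> set (L ! B)"
    using assms(5) by (auto simp: mixed_crossings_def)
  then have "(x, t) \<notin> set (L ! B)" "(x, \<not> t) \<notin> set (L ! A)"
    using assms letter_in_unique_component[OF gauss_code_distinct[OF assms(1)]] by blast+
  then show "(x, s) \<in> set (L ! A) \<longleftrightarrow> (x, \<not> s) \<in> set (L ! B)"
    and "(x, s) \<in> set (L ! A) \<longleftrightarrow> (x, \<not> s) \<notin> set (L ! A)"
    using t by (cases "s = t"; simp)+
qed

text \<open>
  As a vanishing sum, balance can be tracked under deletions in the same way as the polynomial.
\<close>

lemma balanced_iff_sum_signs:
  assumes "is_gauss_code L"
  shows "balanced L \<longleftrightarrow>
    (\<forall>A<length L. \<forall>B<length L. A \<noteq> B \<longrightarrow>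
       (\<Sum>x\<in>mixed_crossings (L ! A) (L ! B). sign_on (L ! A) x) = 0)"
proof -
  have "card {x \<in> mixed_crossings (L ! A) (L ! B). (x, True) \<in> set (L ! A)} =
        card {x \<in> mixed_crossings (L ! A) (L ! B). (x, False) \<in> set (L ! A)} \<longleftrightarrow>
        (\<Sum>x\<in>mixed_crossings (L ! A) (L ! B). sign_on (L ! A) x) = 0"
    if "A < length L" "B < length L" "A \<noteq> B" for A B
  proof -
    let ?M = "mixed_crossings (L ! A) (L ! B)"
    have neg: "?M \<inter> - {x. (x, True) \<in> set (L ! A)} = {x \<in> ?M. (x, False) \<in> set (L ! A)}"
      using mixed_crossing_one_end(2)[OF assms that, of _ True] by auto
    have "(\<Sum>x\<in>?M. sign_on (L ! A) x) =
        int (card {x \<in> ?M. (x, True) \<in> set (L ! A)}) - int (card {x \<in> ?M. (x, False) \<in> set (L ! A)})"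
      unfolding sign_on_def by (simp add: sum.If_cases neg) (simp add: Collect_conj_eq)
    then show ?thesis by simp
  qed
  then show ?thesis unfolding balanced_def by blast
qed

text \<open>
  The letters of the component are sorted by the component \<open>B\<close> that contains the other end of
  their crossing. For \<open>B = A\<close>, exchanging the two ends of each crossing is a sign-reversing
  involution; for \<open>B \<noteq> A\<close>, the sum vanishes by balance.
\<close>

lemma charge_eq_0:
  assumes L: "is_gauss_code L" and "balanced L" and A: "A < length L"
  shows "charge (L ! A) = 0"
proof -
  let ?sgn = "\<lambda>a :: 'a letter. if snd a then 1 else - 1 :: int"
  define S where "S B = {a \<in> set (L ! A). (fst a, \<not> snd a) \<in> set (L ! B)}" for B
  have "charge (L ! A) = (\<Sum>a\<in>set (L ! A). ?sgn a)"
    using distinct_word[OF gauss_code_distinct[OF L], of "L ! A"] A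
    by (simp add: charge_def sum_list_distinct_conv_sum_set)
  also have "set (L ! A) = (\<Union>B<length L. S B)"
  proof -
    have "\<exists>B<length L. (fst a, \<not> snd a) \<in> set (L ! B)" if "a \<in> set (L ! A)" for a
    proof -
      have "a \<in> letters L" using that A by (auto simp: letters_def)
      then have "(fst a, \<not> snd a) \<in> letters L" using L by (auto simp: is_gauss_code_def crossings_def)
      then show ?thesis unfolding letters_def by (metis UN_E in_set_conv_nth set_concat)
    qed
    then show ?thesis unfolding S_def by auto
  qed
  also have "(\<Sum>a\<in>\<dots>. ?sgn a) = (\<Sum>B<length L. \<Sum>a\<in>S B. ?sgn a)"
  proof (rule sum.UNION_disjoint)
    show "\<forall>B\<in>{..<length L}. \<forall>C\<in>{..<length L}. B \<noteq> C \<longrightarrow> S B \<inter> S C = {}"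
      using letter_in_unique_component[OF gauss_code_distinct[OF L]] by (auto simp: S_def)
  qed (auto simp: S_def)
  also have "\<dots> = 0"
  proof (rule sum.neutral, clarify)
    fix B assume B: "B < length L"
    show "(\<Sum>a\<in>S B. ?sgn a) = 0"
    proof (cases "A = B")
      case True
      have "(\<Sum>a\<in>S B. ?sgn a) = (\<Sum>a\<in>S B. - ?sgn a)"
        by (rule sum.reindex_bij_witness[of _ "apsnd Not" "apsnd Not"]) (auto simp: S_def True)
      then show ?thesis by (simp add: sum_negf)
    next
      case False
      have inj: "inj_on fst (S B)"
        using letter_in_unique_component[OF gauss_code_distinct[OF L] A B] False
        by (auto simp: inj_on_def S_def) (metis (full_types))+
      have img: "fst ` S B = mixed_crossings (L ! A) (L ! B)"
        by (force simp: S_def mixed_crossings_def)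
      have "(\<Sum>x\<in>mixed_crossings (L ! A) (L ! B). sign_on (L ! A) x) = (\<Sum>a\<in>S B. sign_on (L ! A) (fst a))"
        unfolding img[symmetric] by (simp add: sum.reindex[OF inj])
      also have "\<dots> = (\<Sum>a\<in>S B. ?sgn a)"
      proof (rule sum.cong[OF refl])
        fix a assume a: "a \<in> S B"
        then have "fst a \<in> mixed_crossings (L ! A) (L ! B)" unfolding img[symmetric] by blast
        from mixed_crossing_one_end(2)[OF L A B False this, of "snd a"] a
        show "sign_on (L ! A) (fst a) = ?sgn a"
          by (cases a; cases "snd a") (auto simp: sign_on_def S_def)
      qed
      finally show ?thesis
        using \<open>balanced L\<close> A B False by (simp add: balanced_iff_sum_signs[OF L])
    qed
  qed
  finally show ?thesis .
qed

text \<open>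
  Since no letter is repeated, one run of partial sums through the concatenation of all codewords
  gives heights for all of them, each word with its own starting value.
\<close>

lemma ex_height:
  assumes "is_gauss_code L" and "balanced L"
  shows "\<exists>H. is_height L H"
proof -
  obtain H where "heights_from H 0 (concat L)"
    using ex_heights_from gauss_code_distinct[OF assms(1)] by blast
  then have "is_height L H"
    using heights_from_concat charge_eq_0[OF assms]
    unfolding is_height_def word_height_def by (metis in_set_conv_nth)
  then show ?thesis by blast
qed

section \<open>The polynomial in terms of heights\<close>

definition index :: "('x letter \<Rightarrow> int) \<Rightarrow> 'x \<Rightarrow> int" where
  "index H x = H (x, False) - H (x, True)"

text \<open>
  Self-crossings of \<open>A\<close> are the mixed crossings of \<open>A\<close> with itself, so the case \<open>A = B\<close> covers
  \<open>p\<^sub>A\<close> and the case \<open>A \<noteq> B\<close> covers \<open>p\<^sub>A\<^sub>,\<^sub>B\<close>. In both cases the value is odd in the index \<open>k\<close>.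
\<close>

definition crossing_term :: "nat \<Rightarrow> nat \<Rightarrow> int \<Rightarrow> link_polynomial" where
  "crossing_term A B k =
     (if A = B then of_int k * indet (Self_Var A) ^ nat \<bar>k\<bar> else indet (Pair_Var {A, B}) * of_int k)"

definition height_poly :: "'x gauss_code \<Rightarrow> ('x letter \<Rightarrow> int) \<Rightarrow> link_polynomial" where
  "height_poly L H =
     (\<Sum>(A, B) \<in> {(A, B). A \<le> B \<and> B < length L}.
        \<Sum>x\<in>mixed_crossings (L ! A) (L ! B). crossing_term A B (index H x))"

lemma crossing_term_0 [simp]: "crossing_term A B 0 = 0"
  by (simp add: crossing_term_def)

lemma crossing_term_uminus: "crossing_term A B (- k) = - crossing_term A B k"
  by (simp add: crossing_term_def)

lemma self_poly_eq_sum_index: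
  assumes "is_gauss_code L" and H: "is_height L H" and A: "A < length L"
  shows "self_poly L A = (\<Sum>x\<in>mixed_crossings (L ! A) (L ! A). crossing_term A A (index H x))"
proof -
  have "eta (L ! A) (x, True) (x, False) = index H x" if "x \<in> self_crossings (L ! A)" for x
    using eta_eq_height_difference[of H "L ! A" "(x, True)" "(x, False)"] that A H
      distinct_word[OF gauss_code_distinct[OF assms(1)], of "L ! A"]
    by (simp add: index_def self_crossings_def is_height_def)
  then show ?thesis
    unfolding self_poly_def self_crossings_eq_mixed[symmetric]
    by (intro sum.cong) (simp_all add: crossing_term_def)
qed

text \<open>
  Regrouping
  \<open>(H(y\<^sup>-) - H(x\<^sup>+)) + (H(x\<^sup>-) - H(y\<^sup>+)) = (H(x\<^sup>-) - H(x\<^sup>+)) + (H(y\<^sup>-) - H(y\<^sup>+))\<close>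
  separates \<open>x\<close> from \<open>y\<close>, and every crossing lies in exactly one pair.
\<close>

lemma pair_poly_eq_sum_index:
  assumes L: "is_gauss_code L" and H: "is_height L H" and A: "A < length L" and B: "B < length L"
    and AB: "A \<noteq> B" and P: "is_pairing (L ! A) (L ! B) P"
  shows "pair_poly L A B P = (\<Sum>x\<in>mixed_crossings (L ! A) (L ! B). crossing_term A B (index H x))"
proof -
  let ?M = "mixed_crossings (L ! A) (L ! B)"
  define T where "T = {(x, y). {x, y} \<in> P \<and>
                (x, True) \<in> set (L ! A) \<and> (y, False) \<in> set (L ! A) \<and>
                (x, False) \<in> set (L ! B) \<and> (y, True) \<in> set (L ! B)}"
  have part: "\<Union>P = ?M" "disjoint P" "\<And>p. p \<in> P \<Longrightarrow> p \<subseteq> ?M"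
    using P by (auto simp: is_pairing_def partition_on_def)
  note unique = letter_in_unique_component[OF gauss_code_distinct[OF L]]
  have neq: "x \<noteq> y" if "(x, y) \<in> T" for x y
    using that unique[OF A B, of "(x, False)"] AB by (auto simp: T_def)
  have "(\<Sum>(x, y)\<in>T. eta (L ! A) (x, True) (y, False) + eta (L ! B) (y, True) (x, False)) =
        (\<Sum>(x, y)\<in>T. index H x + index H y)"
  proof (rule sum.cong[OF refl], clarify)
    fix x y assume xy: "(x, y) \<in> T"
    have "word_height H (L ! A)" "word_height H (L ! B)" "distinct (L ! A)" "distinct (L ! B)"
      using H A B distinct_word[OF gauss_code_distinct[OF L]] by (auto simp: is_height_def)
    then show "eta (L ! A) (x, True) (y, False) + eta (L ! B) (y, True) (x, False) =
        index H x + index H y"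
      using xy eta_eq_height_difference[of H "L ! A" "(x, True)" "(y, False)"]
        eta_eq_height_difference[of H "L ! B" "(y, True)" "(x, False)"]
      by (simp add: T_def index_def)
  qed
  also have "\<dots> = (\<Sum>q\<in>T. \<Sum>x\<in>{fst q, snd q}. index H x)"
    using neq by (intro sum.cong) auto
  \<comment> \<open>Each pair has exactly one admissible labelling, since an end of a crossing lies in only one
    of the two components.\<close>
  also have "\<dots> = (\<Sum>p\<in>P. \<Sum>x\<in>p. index H x)"
  proof (rule sum.reindex_bij_betw[of "\<lambda>q. {fst q, snd q}" T P "\<lambda>p. \<Sum>x\<in>p. index H x"])
    have "inj_on (\<lambda>q. {fst q, snd q}) T"
    proof (rule inj_onI, clarsimp)
      fix x y x' y' assume *: "(x, y) \<in> T" "(x', y') \<in> T" "{x, y} = {x', y'}"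
      show "x = x' \<and> y = y'"
      proof (rule ccontr)
        assume "\<not> (x = x' \<and> y = y')"
        with *(3) have "x' = y" by (auto simp: doubleton_eq_iff)
        then show False using * unique[OF A B, of "(y, True)"] AB by (auto simp: T_def)
      qed
    qed
    moreover have "p \<in> (\<lambda>q. {fst q, snd q}) ` T" if p: "p \<in> P" for p
    proof -
      obtain x y where xy: "p = {x, y}"
        "(x, True) \<in> set (L ! A) \<and> (y, False) \<in> set (L ! A) \<or>
         (x, True) \<in> set (L ! B) \<and> (y, False) \<in> set (L ! B)"
        using P p unfolding is_pairing_def by blast
      have M: "x \<in> ?M" "y \<in> ?M" using part(3)[OF p] xy(1) by auto
      note ends = mixed_crossing_one_end(1)[OF L A B AB]
      have "(x, y) \<in> T \<or> (y, x) \<in> T"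
        using xy p ends[OF M(1), of True] ends[OF M(1), of False]
          ends[OF M(2), of True] ends[OF M(2), of False]
        unfolding T_def by (auto simp: insert_commute)
      then show ?thesis using xy(1) by (force simp: insert_commute)
    qed
    moreover have "(\<lambda>q. {fst q, snd q}) ` T \<subseteq> P" by (auto simp: T_def)
    ultimately show "bij_betw (\<lambda>q. {fst q, snd q}) T P" unfolding bij_betw_def by blast
  qed
  also have "\<dots> = (\<Sum>x\<in>?M. index H x)"
    unfolding part(1)[symmetric] using part
    by (subst sum.Union_disjoint) (auto simp: disjoint_def intro: finite_subset)
  finally show ?thesis
    using AB by (simp add: pair_poly_def T_def[symmetric] crossing_term_def sum_distrib_left)
qed

lemma link_poly_eq_height_poly:
  assumes "is_gauss_code L" and "is_height L H" and P: "pairing_choice L P"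
  shows "link_poly L P = height_poly L H"
proof -
  let ?g = "\<lambda>(A, B). \<Sum>x\<in>mixed_crossings (L ! A) (L ! B). crossing_term A B (index H x)"
  let ?S = "{(A, B). A < B \<and> B < length L}"
  have fin: "finite ?S" by (rule finite_subset[of _ "{..<length L} \<times> {..<length L}"]) auto
  have split: "{(A, B). A \<le> B \<and> B < length L} = (\<lambda>A. (A, A)) ` {..<length L} \<union> ?S" by auto
  have "height_poly L H = sum ?g ((\<lambda>A. (A, A)) ` {..<length L}) + sum ?g ?S"
    unfolding height_poly_def split by (rule sum.union_disjoint) (use fin in auto)
  moreover have "sum ?g ((\<lambda>A. (A, A)) ` {..<length L}) = (\<Sum>A<length L. self_poly L A)"
    using assms by (subst sum.reindex) (auto simp: inj_on_def self_poly_eq_sum_index intro!: sum.cong)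
  moreover have "sum ?g ?S = (\<Sum>(A, B)\<in>?S. pair_poly L A B (P A B))"
    using assms by (intro sum.cong) (auto simp: pair_poly_eq_sum_index pairing_choice_def)
  ultimately show ?thesis by (simp add: link_poly_def)
qed

text \<open>
  Balance gives a bijection from the crossings with \<open>+\<close> end on \<open>A\<close> to those with \<open>-\<close> end on \<open>A\<close>;
  each crossing is paired with its image.
\<close>

lemma ex_pairing_choice:
  assumes L: "is_gauss_code L" and "balanced L"
  shows "\<exists>P. pairing_choice L P"
proof -
  have "\<exists>P. is_pairing (L ! A) (L ! B) P" if A: "A < length L" and B: "B < length L" and AB: "A \<noteq> B" for A B
  proof -
    let ?M = "mixed_crossings (L ! A) (L ! B)"
    let ?X = "{x \<in> ?M. (x, True) \<in> set (L ! A)}"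
    let ?Y = "{x \<in> ?M. (x, False) \<in> set (L ! A)}"
    obtain h where h: "bij_betw h ?X ?Y"
      using \<open>balanced L\<close> A B AB finite_same_card_bij[of ?X ?Y] by (auto simp: balanced_def)
    have disj: "?X \<inter> ?Y = {}" and un: "?X \<union> ?Y = ?M"
      using mixed_crossing_one_end(2)[OF L A B AB, of _ True] by auto
    have hY: "h x \<in> ?Y" if "x \<in> ?X" for x using h that by (auto simp: bij_betw_def)
    have "partition_on ?M ((\<lambda>x. {x, h x}) ` ?X)"
    proof (rule partition_onI)
      have "\<Union> ((\<lambda>x. {x, h x}) ` ?X) = ?X \<union> h ` ?X" by auto
      then show "\<Union> ((\<lambda>x. {x, h x}) ` ?X) = ?M" using h un by (simp add: bij_betw_def)
    next
      fix p q assume "p \<in> (\<lambda>x. {x, h x}) ` ?X" "q \<in> (\<lambda>x. {x, h x}) ` ?X" "p \<noteq> q"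
      then obtain x y where xy: "p = {x, h x}" "q = {y, h y}" "x \<in> ?X" "y \<in> ?X" "x \<noteq> y" by auto
      have "h x \<noteq> h y" using h xy by (auto simp: bij_betw_def inj_on_def)
      then show "disjnt p q" using xy hY[of x] hY[of y] disj by (auto simp: disjnt_def)
    qed auto
    then have "is_pairing (L ! A) (L ! B) ((\<lambda>x. {x, h x}) ` ?X)"
      unfolding is_pairing_def using hY disj by fastforce
    then show ?thesis ..
  qed
  then have "pairing_choice L (\<lambda>A B. SOME P. is_pairing (L ! A) (L ! B) P)"
    unfolding pairing_choice_def by (metis (no_types, lifting) someI_ex less_trans nat_neq_iff)
  then show ?thesis by blast
qed


section \<open>Transformations of Gauss codes\<close>

lemma nth_rotate_cong:
  assumes "list_all2 (\<lambda>w w'. \<exists>n. w' = rotate n w) L L'"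
  shows "length L' = length L" and "\<And>A. A < length L \<Longrightarrow> set (L' ! A) = set (L ! A)"
  using assms by (auto simp: list_all2_conv_all_nth)

lemma height_poly_cong:
  assumes "length L' = length L" and "\<And>A. A < length L \<Longrightarrow> set (L' ! A) = set (L ! A)"
    and "\<And>x. index H' x = index H x"
  shows "height_poly L' H' = height_poly L H"
proof -
  have "mixed_crossings (L' ! A) (L' ! B) = mixed_crossings (L ! A) (L ! B)"
    if "A < length L" "B < length L" for A B
    using assms(2) that by (simp add: mixed_crossings_def)
  then show ?thesis using assms(1,3) by (auto simp: height_poly_def intro!: sum.cong)
qed

lemma balanced_cong:
  assumes "length L' = length L" and "\<And>A. A < length L \<Longrightarrow> set (L' ! A) = set (L ! A)"
  shows "balanced L' \<longleftrightarrow> balanced L"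
proof -
  have "mixed_crossings (L' ! A) (L' ! B) = mixed_crossings (L ! A) (L ! B)"
    if "A < length L" "B < length L" for A B
    using assms(2) that by (simp add: mixed_crossings_def)
  then show ?thesis using assms by (simp add: balanced_def)
qed

lemma is_gauss_code_mset_cong:
  assumes "mset (concat L') = mset (concat L)"
  shows "is_gauss_code L' \<longleftrightarrow> is_gauss_code L"
  unfolding is_gauss_code_def crossings_def letters_def
  using mset_eq_imp_distinct_iff[OF assms] mset_eq_setD[OF assms] by simp

lemma mset_concat_rotations:
  "list_all2 (\<lambda>w w'. \<exists>n. w' = rotate n w) L L' \<Longrightarrow> mset (concat L') = mset (concat L)"
proof (induction rule: list_all2_induct)
  case (Cons w L w' L')
  then obtain n where "w' = rotate n w" by blast
  moreover have "mset (rotate n w) = mset w"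
    by (metis append_take_drop_id mset_append rotate_drop_take union_commute)
  ultimately show ?case using Cons by simp
qed simp

lemma consecutive_height:
  assumes "consecutive L a b" and "is_height L H"
  shows "H b = H a + of_bool (snd a) + of_bool (snd b) - 1"
proof -
  obtain w n v where w: "w \<in> set L" "rotate n w = a # b # v"
    using assms(1) by (auto simp: consecutive_def)
  then have "word_height H (a # b # v)"
    using assms(2) word_height_rotate[of H n w] by (simp add: is_height_def)
  then show ?thesis by (auto simp: word_height_def)
qed

lemma consecutive_same_component:
  assumes "consecutive L a b"
  obtains i where "i < length L" and "a \<in> set (L ! i)" and "b \<in> set (L ! i)"
proof -
  obtain w n v where w: "w \<in> set L" "rotate n w = a # b # v"
    using assms by (auto simp: consecutive_def)
  then have "a \<in> set w" "b \<in> set w"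
    by (metis list.set_intros set_rotate)+
  then show ?thesis using that w(1) by (metis in_set_conv_nth)
qed

lemma consecutive_filter:
  assumes "consecutive L a b" and "P a" and "P b"
  shows "consecutive (map (filter P) L) a b"
proof -
  obtain w n v where w: "w \<in> set L" "rotate n w = a # b # v"
    using assms by (auto simp: consecutive_def)
  obtain m where "rotate m (filter P w) = a # b # filter P v"
    using filter_rotate[of P n w] w(2) assms by auto
  then show ?thesis using w(1) by (auto simp: consecutive_def)
qed

lemma consecutive_map:
  assumes "consecutive L a b"
  shows "consecutive (map (map f) L) (f a) (f b)"
proof -
  obtain w n v where w: "w \<in> set L" "rotate n w = a # b # v"
    using assms by (auto simp: consecutive_def)
  then have "rotate n (map f w) = f a # f b # map f v" by (simp add: rotate_map)
  then show ?thesis using w(1) by (auto simp: consecutive_def)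
qed

text \<open>
  After a rotation the pair stands at the beginning of its word. The partial sum returns to its
  starting value after the pair, so the same function is a height of the rest.
\<close>

lemma is_height_delete_pair:
  assumes d: "distinct (concat L)" and "consecutive L a b" and sgn: "snd a \<noteq> snd b"
    and H: "is_height L H"
  shows "is_height (map (filter (\<lambda>c. c \<notin> {a, b})) L) H"
proof -
  let ?P = "\<lambda>c. c \<notin> {a, b}"
  obtain w n v where w: "w \<in> set L" and rot: "rotate n w = a # b # v"
    using assms(2) by (auto simp: consecutive_def)
  have ab: "a \<in> set w" "b \<in> set w" using rot by (metis list.set_intros set_rotate)+
  have "distinct (a # b # v)" using distinct_word[OF d w] rot by (metis distinct_rotate)
  then have v: "filter ?P (rotate n w) = v"
    unfolding rot by (auto intro!: filter_True)
  have "word_height H (filter ?P w')" if w': "w' \<in> set L" for w'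
  proof (cases "w' = w")
    case True
    have "word_height H (a # b # v)" using H w rot word_height_rotate[of H n w] by (simp add: is_height_def)
    then have "word_height H v" using sgn by (auto simp: word_height_def split: if_splits)
    then show ?thesis
      using filter_rotate[of ?P n w] v True by auto
  next
    case False
    then have "a \<notin> set w'" "b \<notin> set w'" using letter_in_unique_word[OF d] w w' ab by blast+
    then have "filter ?P w' = w'" by (intro filter_True) auto
    then show ?thesis using H w' by (simp add: is_height_def)
  qed
  then show ?thesis by (auto simp: is_height_def)
qed

lemma mixed_crossings_delete:
  "mixed_crossings (filter (\<lambda>a. fst a \<notin> E) v) (filter (\<lambda>a. fst a \<notin> E) w) = mixed_crossings v w - E"
  by (auto simp: mixed_crossings_def)

lemma is_gauss_code_delete:
  assumes "is_gauss_code L"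
  shows "is_gauss_code (delete_crossings E L)"
proof -
  have *: "concat (delete_crossings E L) = filter (\<lambda>a. fst a \<notin> E) (concat L)"
    by (simp add: delete_crossings_def filter_concat)
  have "letters (delete_crossings E L) = {a \<in> letters L. fst a \<notin> E}"
    unfolding letters_def * by simp
  then show ?thesis
    using assms unfolding is_gauss_code_def * by (auto simp: crossings_def)
qed

lemma height_poly_delete:
  assumes "\<And>A B. A \<le> B \<Longrightarrow> B < length L \<Longrightarrow>
    (\<Sum>x\<in>mixed_crossings (L ! A) (L ! B) \<inter> E. crossing_term A B (index H x)) = 0"
  shows "height_poly (delete_crossings E L) H = height_poly L H"
proof -
  have "(\<Sum>x\<in>mixed_crossings (L ! A) (L ! B) - E. crossing_term A B (index H x)) =
        (\<Sum>x\<in>mixed_crossings (L ! A) (L ! B). crossing_term A B (index H x))"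
    if "A \<le> B" "B < length L" for A B
    using assms[OF that]
      sum.Int_Diff[of "mixed_crossings (L ! A) (L ! B)" "\<lambda>x. crossing_term A B (index H x)" E] by simp
  then show ?thesis
    unfolding height_poly_def delete_crossings_def
    by (intro sum.cong) (auto simp: mixed_crossings_delete)
qed

lemma balanced_delete:
  assumes "is_gauss_code L"
    and "\<And>A B. A < length L \<Longrightarrow> B < length L \<Longrightarrow> A \<noteq> B \<Longrightarrow>
      (\<Sum>x\<in>mixed_crossings (L ! A) (L ! B) \<inter> E. sign_on (L ! A) x) = 0"
  shows "balanced (delete_crossings E L) \<longleftrightarrow> balanced L"
proof -
  have "(\<Sum>x\<in>mixed_crossings (delete_crossings E L ! A) (delete_crossings E L ! B).
           sign_on (delete_crossings E L ! A) x) =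
        (\<Sum>x\<in>mixed_crossings (L ! A) (L ! B). sign_on (L ! A) x)"
    if "A < length L" "B < length L" "A \<noteq> B" for A B
  proof -
    have "(\<Sum>x\<in>mixed_crossings (delete_crossings E L ! A) (delete_crossings E L ! B).
           sign_on (delete_crossings E L ! A) x) =
          (\<Sum>x\<in>mixed_crossings (L ! A) (L ! B) - E. sign_on (L ! A) x)"
      using that by (auto simp: delete_crossings_def mixed_crossings_delete sign_on_def intro!: sum.cong)
    then show ?thesis
      using assms(2)[OF that]
        sum.Int_Diff[of "mixed_crossings (L ! A) (L ! B)" "sign_on (L ! A)" E] by simp
  qed
  moreover have "length (delete_crossings E L) = length L" by (simp add: delete_crossings_def)
  ultimately show ?thesis
    by (simp add: balanced_iff_sum_signs[OF assms(1)] balanced_iff_sum_signs[OF is_gauss_code_delete[OF assms(1)]])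
qed

lemma swap_letters_eq:
  assumes "consecutive L a b"
  shows "length (swap_letters a b L) = length L"
    and "A < length L \<Longrightarrow> distinct (concat L) \<Longrightarrow> set (swap_letters a b L ! A) = set (L ! A)"
proof -
  show "length (swap_letters a b L) = length L" by (simp add: swap_letters_def)
  assume A: "A < length L" and d: "distinct (concat L)"
  obtain i where i: "i < length L" "a \<in> set (L ! i)" "b \<in> set (L ! i)"
    using assms by (rule consecutive_same_component)
  then have "a \<in> set (L ! A) \<longleftrightarrow> b \<in> set (L ! A)" using letter_in_unique_component[OF d A] by blast
  then have "Transposition.transpose a b ` set (L ! A) = set (L ! A)" by (rule transpose_image_eq)
  then show "set (swap_letters a b L ! A) = set (L ! A)" using A by (simp add: swap_letters_def)
qed

lemma is_gauss_code_swap: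
  assumes "consecutive L a b" and L: "is_gauss_code L"
  shows "is_gauss_code (swap_letters a b L)"
proof -
  have *: "concat (swap_letters a b L) = map (Transposition.transpose a b) (concat L)"
    by (simp add: swap_letters_def map_concat)
  have "distinct (concat (swap_letters a b L))"
    unfolding * using L by (simp add: distinct_map gauss_code_distinct del: map_concat)
  moreover have "letters (swap_letters a b L) = letters L"
    using swap_letters_eq[OF assms(1)] gauss_code_distinct[OF L]
    by (auto simp: letters_def) (metis in_set_conv_nth)+
  ultimately show ?thesis using L by (simp add: is_gauss_code_def crossings_def)
qed

text \<open>
  In the order \<open>a b\<close> both letters touch the peak \<open>c + 1\<close> above the starting value \<open>c\<close>; in the
  order \<open>b a\<close> they lie around the valley \<open>c - 1\<close>, and the larger partial sum next to each is \<open>c\<close>.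
  The partial sum after the pair is the same.
\<close>

lemma is_height_swap:
  assumes d: "distinct (concat L)" and "consecutive L a b" and sgn: "snd a" "\<not> snd b"
    and H: "is_height L H"
  shows "is_height (swap_letters a b L) (\<lambda>c. H c - of_bool (c \<in> {a, b}))"
proof -
  let ?t = "Transposition.transpose a b" and ?H = "\<lambda>c. H c - of_bool (c \<in> {a, b})"
  obtain w n v where w: "w \<in> set L" and rot: "rotate n w = a # b # v"
    using assms(2) by (auto simp: consecutive_def)
  have ab: "a \<in> set w" "b \<in> set w" using rot by (metis list.set_intros set_rotate)+
  have dist: "distinct (a # b # v)" using distinct_word[OF d w] rot by (metis distinct_rotate)
  have "word_height ?H (map ?t w')" if w': "w' \<in> set L" for w'
  proof (cases "w' = w")
    case True
    have "word_height H (a # b # v)" using H w rot word_height_rotate[of H n w] by (simp add: is_height_def)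
    then obtain c where c: "H a = c + 1" "H b = c + 1" "heights_from H c v" "charge v = 0"
      using sgn by (auto simp: word_height_def)
    have "heights_from ?H c v \<longleftrightarrow> heights_from H c v"
      using dist by (intro heights_from_cong) auto
    then have "heights_from ?H c (b # a # v)" using c sgn by simp
    then have "word_height ?H (b # a # v)"
      using c(4) sgn unfolding word_height_def by auto
    moreover have "map ?t v = v" using dist by (intro map_idI) (auto simp: transpose_def)
    then have "rotate n (map ?t w) = b # a # v" by (simp add: rotate_map rot)
    ultimately show ?thesis using True word_height_rotate[of ?H n "map ?t w"] by simp
  next
    case False
    then have no: "a \<notin> set w'" "b \<notin> set w'" using letter_in_unique_word[OF d] w w' ab by blast+
    then have "map ?t w' = w'" by (intro map_idI) (auto simp: transpose_def)
    moreover have "word_height ?H w' \<longleftrightarrow> word_height H w'"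
      using no by (intro word_height_cong) auto
    ultimately show ?thesis using H w' by (simp add: is_height_def)
  qed
  then show ?thesis by (auto simp: is_height_def swap_letters_def)
qed

lemma consecutive_swap:
  assumes "consecutive L c d" and "c \<notin> {a, b}" and "d \<notin> {a, b}"
  shows "consecutive (swap_letters a b L) c d"
  using consecutive_map[OF assms(1), of "Transposition.transpose a b"] assms(2,3)
  by (simp add: swap_letters_def transpose_def)

section \<open>Invariance under the moves\<close>

text \<open>
  Heights are transported in one direction only, from \<open>L\<close> to \<open>L'\<close>. This suffices for both
  directions of a move, because balance also holds for both codes or for neither and a balanced
  \<open>L\<close> has a height.
\<close>

definition same_invariants :: "'x gauss_code \<Rightarrow> 'x gauss_code \<Rightarrow> bool" where
  "same_invariants L L' \<longleftrightarrow>
     is_gauss_code L \<and> is_gauss_code L' \<and> (balanced L \<longleftrightarrow> balanced L') \<and>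
     (\<forall>H. is_height L H \<longrightarrow> (\<exists>H'. is_height L' H' \<and> height_poly L' H' = height_poly L H))"

text \<open>
  The same function is a height of the rotated code.
\<close>

lemma same_invariants_rotation:
  assumes "is_gauss_code L" and r: "list_all2 (\<lambda>w w'. \<exists>n. w' = rotate n w) L L'"
  shows "same_invariants L L'"
proof -
  have "is_height L' H" if "is_height L H" for H
    using r that by (induction rule: list_all2_induct) (auto simp: is_height_def)
  moreover have "height_poly L' H = height_poly L H" for H
    by (rule height_poly_cong) (use nth_rotate_cong[OF r] in auto)
  moreover have "balanced L' \<longleftrightarrow> balanced L"
    by (rule balanced_cong) (use nth_rotate_cong[OF r] in auto)
  ultimately show ?thesis
    using assms(1) is_gauss_code_mset_cong[OF mset_concat_rotations[OF r]]
    unfolding same_invariants_def by blast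
qed

lemma same_invariants_relabelling:
  assumes L: "is_gauss_code L" and f: "inj_on f (crossings L)"
  shows "same_invariants L (map (map (apfst f)) L)"
proof -
  let ?L = "map (map (apfst f)) L"
  have cross: "x \<in> crossings L" if "A < length L" "(x, s) \<in> set (L ! A)" for x s A
    using that by (force simp: crossings_def letters_def)
  have inj_letters: "inj_on (apfst f) (letters L)"
    using f by (force simp: inj_on_def crossings_def)
  have letters: "letters ?L = apfst f ` letters L" by (auto simp: letters_def)
  have "concat ?L = map (apfst f) (concat L)" by (simp add: map_concat)
  then have "distinct (concat ?L)"
    using inj_letters gauss_code_distinct[OF L] by (simp add: distinct_map letters_def del: map_concat)
  moreover have "(f x, s) \<in> letters ?L" if "(x, t) \<in> letters L" for x s t
    unfolding letters using that L by (force simp: is_gauss_code_def crossings_def)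
  ultimately have L': "is_gauss_code ?L"
    by (auto simp: is_gauss_code_def crossings_def letters)
  have letter_iff: "(f x, s) \<in> set (?L ! A) \<longleftrightarrow> (x, s) \<in> set (L ! A)"
    if A: "A < length L" and x: "x \<in> crossings L" for A x s
  proof
    assume "(f x, s) \<in> set (?L ! A)"
    then obtain y where y: "(y, s) \<in> set (L ! A)" "f x = f y" using A by auto
    then show "(x, s) \<in> set (L ! A)" using inj_onD[OF f y(2) x cross[OF A y(1)]] by simp
  qed (use A in force)
  have mixed: "mixed_crossings (?L ! A) (?L ! B) = f ` mixed_crossings (L ! A) (L ! B)"
    and inj: "inj_on f (mixed_crossings (L ! A) (L ! B))"
    if A: "A < length L" and B: "B < length L" for A B
  proof -
    show "inj_on f (mixed_crossings (L ! A) (L ! B))"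
      using f by (rule inj_on_subset) (auto simp: mixed_crossings_def intro: cross[OF A])
    show "mixed_crossings (?L ! A) (?L ! B) = f ` mixed_crossings (L ! A) (L ! B)"
    proof (intro equalityI subsetI)
      fix x' assume "x' \<in> mixed_crossings (?L ! A) (?L ! B)"
      then obtain s where A': "(x', s) \<in> set (?L ! A)" and B': "(x', \<not> s) \<in> set (?L ! B)"
        by (auto simp: mixed_crossings_def)
      from A' A obtain x where x: "(x, s) \<in> set (L ! A)" "x' = f x" by auto
      moreover have "(x, \<not> s) \<in> set (L ! B)"
        using B' letter_iff[OF B cross[OF A x(1)]] x(2) by simp
      ultimately show "x' \<in> f ` mixed_crossings (L ! A) (L ! B)"
        by (auto simp: mixed_crossings_def)
    next
      fix x' assume "x' \<in> f ` mixed_crossings (L ! A) (L ! B)"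
      then obtain x s where x: "x' = f x" "(x, s) \<in> set (L ! A)" "(x, \<not> s) \<in> set (L ! B)"
        by (auto simp: mixed_crossings_def)
      have "(x', s) \<in> set (?L ! A)" "(x', \<not> s) \<in> set (?L ! B)"
        using x letter_iff[OF A cross[OF A x(2)]] letter_iff[OF B cross[OF B x(3)]] by simp_all
      then show "x' \<in> mixed_crossings (?L ! A) (?L ! B)"
        unfolding mixed_crossings_def by blast
    qed
  qed
  have sign: "sign_on (?L ! A) (f x) = sign_on (L ! A) x" if "A < length L" "x \<in> crossings L" for A x
    unfolding sign_on_def letter_iff[OF that] ..
  have "(\<Sum>x\<in>mixed_crossings (?L ! A) (?L ! B). sign_on (?L ! A) x) =
        (\<Sum>x\<in>mixed_crossings (L ! A) (L ! B). sign_on (L ! A) x)"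
    if A: "A < length L" and B: "B < length L" for A B
    unfolding mixed[OF that] sum.reindex[OF inj[OF that]] comp_def
    by (intro sum.cong refl sign[OF A]) (auto simp: mixed_crossings_def intro: cross[OF A])
  then have bal: "balanced L \<longleftrightarrow> balanced ?L"
    by (simp add: balanced_iff_sum_signs[OF L] balanced_iff_sum_signs[OF L'] del: nth_map)
  have "\<exists>H'. is_height ?L H' \<and> height_poly ?L H' = height_poly L H" if H: "is_height L H" for H
  proof -
    define H' where "H' = H \<circ> apfst (inv_into (crossings L) f)"
    have inv: "H' (f x, s) = H (x, s)" if "x \<in> crossings L" for x s
      using f that by (simp add: H'_def)
    have "word_height H' (map (apfst f) w)" if w: "w \<in> set L" for w
    proof -
      have "word_height (H' \<circ> apfst f) w \<longleftrightarrow> word_height H w"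
      proof (rule word_height_cong)
        fix a assume "a \<in> set w"
        then have "fst a \<in> crossings L" using w by (auto simp: crossings_def letters_def)
        then show "(H' \<circ> apfst f) a = H a" by (cases a) (simp add: inv)
      qed
      then show ?thesis
        using H w by (simp add: word_height_def is_height_def charge_map_apfst heights_from_map_apfst)
    qed
    then have "is_height ?L H'" by (simp add: is_height_def)
    moreover have "(\<Sum>x\<in>mixed_crossings (?L ! A) (?L ! B). crossing_term A B (index H' x)) =
        (\<Sum>x\<in>mixed_crossings (L ! A) (L ! B). crossing_term A B (index H x))"
      if A: "A < length L" and B: "B < length L" for A B
      unfolding mixed[OF that] sum.reindex[OF inj[OF that]] comp_def
      by (intro sum.cong refl)
        (auto simp: index_def inv mixed_crossings_def cross[OF A])
    then have "height_poly ?L H' = height_poly L H"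
      unfolding height_poly_def length_map
      by (intro sum.cong refl) (auto simp del: nth_map)
    ultimately show ?thesis by blast
  qed
  then show ?thesis using L L' bal by (simp add: same_invariants_def)
qed

text \<open>
  The two ends of the deleted crossing are next to each other, so its index is \<open>0\<close>; it is a
  self-crossing, so balance is not affected.
\<close>

lemma same_invariants_type_I:
  assumes L: "is_gauss_code L" and c: "consecutive L (e, s) (e, \<not> s)"
  shows "same_invariants L (delete_crossings {e} L)"
proof -
  obtain i where i: "i < length L" "(e, s) \<in> set (L ! i)" "(e, \<not> s) \<in> set (L ! i)"
    using c by (rule consecutive_same_component)
  have "balanced (delete_crossings {e} L) \<longleftrightarrow> balanced L"
  proof (rule balanced_delete[OF L])
    fix A B assume "A < length L" "B < length L" "A \<noteq> B"
    then have "mixed_crossings (L ! A) (L ! B) \<inter> {e} = {}"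
      using mixed_crossings_iff_components[OF L i(1) i(1) _ _ i(2,3)] by auto
    then show "(\<Sum>x\<in>mixed_crossings (L ! A) (L ! B) \<inter> {e}. sign_on (L ! A) x) = 0" by simp
  qed
  moreover have "is_height (delete_crossings {e} L) H \<and>
      height_poly (delete_crossings {e} L) H = height_poly L H" if H: "is_height L H" for H
  proof
    have "delete_crossings {e} L = map (filter (\<lambda>c. c \<notin> {(e, s), (e, \<not> s)})) L"
      unfolding delete_crossings_def by (intro map_cong filter_cong refl) auto
    then show "is_height (delete_crossings {e} L) H"
      using is_height_delete_pair[OF gauss_code_distinct[OF L] c _ H] by simp
    have "index H e = 0" using consecutive_height[OF c H] by (cases s) (auto simp: index_def)
    then show "height_poly (delete_crossings {e} L) H = height_poly L H"
      by (intro height_poly_delete sum.neutral) auto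
  qed
  ultimately show ?thesis using L is_gauss_code_delete[OF L] unfolding same_invariants_def by blast
qed

text \<open>
  For \<open>s = +\<close> the two consecutive pairs give \<open>H(e\<^sup>+) = H(f\<^sup>-)\<close> and \<open>H(e\<^sup>-) = H(f\<^sup>+)\<close>, so the indices
  of \<open>e\<close> and \<open>f\<close> are opposite; the case \<open>s = -\<close> is alike. The crossings join the same two
  components, with opposite signs on each, so their contributions to the polynomial and to the
  balance cancel.
\<close>

lemma same_invariants_type_II:
  assumes L: "is_gauss_code L" and ef: "e \<noteq> f" and c1: "consecutive L (e, s) (f, \<not> s)"
    and c2: "consecutive L (e, \<not> s) (f, s) \<or> consecutive L (f, s) (e, \<not> s)"
  shows "same_invariants L (delete_crossings {e, f} L)"
proof -
  obtain i where i: "i < length L" "(e, s) \<in> set (L ! i)" "(f, \<not> s) \<in> set (L ! i)"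
    using c1 by (rule consecutive_same_component)
  obtain j where j: "j < length L" "(e, \<not> s) \<in> set (L ! j)" "(f, s) \<in> set (L ! j)"
    using c2 by (auto elim: consecutive_same_component)
  have e_mixed: "e \<in> mixed_crossings (L ! A) (L ! B) \<longleftrightarrow> A = i \<and> B = j \<or> A = j \<and> B = i"
    and f_mixed: "f \<in> mixed_crossings (L ! A) (L ! B) \<longleftrightarrow> A = i \<and> B = j \<or> A = j \<and> B = i"
    if "A < length L" "B < length L" for A B
    using mixed_crossings_iff_components[OF L i(1) j(1) that i(2) j(2)]
      mixed_crossings_iff_components[OF L j(1) i(1) that j(3) i(3)] by auto
  have cancel: "(\<Sum>x\<in>mixed_crossings (L ! A) (L ! B) \<inter> {e, f}. g x) = 0"
    if "A < length L" "B < length L" and "e \<in> mixed_crossings (L ! A) (L ! B) \<Longrightarrow> g e + g f = 0"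
    for A B and g :: "'a \<Rightarrow> 'b :: ab_group_add"
  proof (cases "e \<in> mixed_crossings (L ! A) (L ! B)")
    case True
    then have "mixed_crossings (L ! A) (L ! B) \<inter> {e, f} = {e, f}"
      using e_mixed[OF that(1,2)] f_mixed[OF that(1,2)] by auto
    then show ?thesis using ef that(3)[OF True] by simp
  next
    case False
    then have "mixed_crossings (L ! A) (L ! B) \<inter> {e, f} = {}"
      using e_mixed[OF that(1,2)] f_mixed[OF that(1,2)] by auto
    then show ?thesis by simp
  qed
  have "balanced (delete_crossings {e, f} L) \<longleftrightarrow> balanced L"
  proof (rule balanced_delete[OF L])
    fix A B assume A: "A < length L" and B: "B < length L" and AB: "A \<noteq> B"
    show "(\<Sum>x\<in>mixed_crossings (L ! A) (L ! B) \<inter> {e, f}. sign_on (L ! A) x) = 0"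
    proof (rule cancel[OF A B])
      assume e: "e \<in> mixed_crossings (L ! A) (L ! B)"
      then have f: "f \<in> mixed_crossings (L ! A) (L ! B)" using e_mixed[OF A B] f_mixed[OF A B] by simp
      have "A = i \<or> A = j" using e e_mixed[OF A B] by auto
      then have "(e, s) \<in> set (L ! A) \<and> (f, \<not> s) \<in> set (L ! A) \<or>
          (e, \<not> s) \<in> set (L ! A) \<and> (f, \<not> \<not> s) \<in> set (L ! A)"
        using i j by auto
      then obtain t where "(e, t) \<in> set (L ! A)" "(f, \<not> t) \<in> set (L ! A)" by blast
      then show "sign_on (L ! A) e + sign_on (L ! A) f = 0"
        using mixed_crossing_one_end(2)[OF L A B AB e, of True]
          mixed_crossing_one_end(2)[OF L A B AB f, of True] by (cases t) (auto simp: sign_on_def)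
    qed
  qed
  moreover have "is_height (delete_crossings {e, f} L) H \<and>
      height_poly (delete_crossings {e, f} L) H = height_poly L H" if H: "is_height L H" for H
  proof
    \<comment> \<open>The consecutive pairs are deleted one after the other; the second one is still consecutive
      when the first one is gone.\<close>
    let ?L = "map (filter (\<lambda>c. c \<notin> {(e, s), (f, \<not> s)})) L"
    have "distinct (concat ?L)"
      using gauss_code_distinct[OF L] by (simp flip: filter_concat)
    moreover have "is_height ?L H"
      using is_height_delete_pair[OF gauss_code_distinct[OF L] c1 _ H] by simp
    moreover have "consecutive ?L (e, \<not> s) (f, s) \<or> consecutive ?L (f, s) (e, \<not> s)"
      using c2 ef by (auto intro: consecutive_filter)
    ultimately have "is_height (map (filter (\<lambda>c. c \<notin> {(e, \<not> s), (f, s)})) ?L) H"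
      using is_height_delete_pair[of ?L "(e, \<not> s)" "(f, s)" H]
        is_height_delete_pair[of ?L "(f, s)" "(e, \<not> s)" H] by (auto simp: insert_commute)
    moreover have "delete_crossings {e, f} L = map (filter (\<lambda>c. c \<notin> {(e, \<not> s), (f, s)})) ?L"
      unfolding delete_crossings_def map_map comp_def filter_filter
      by (intro map_cong filter_cong refl) auto
    ultimately show "is_height (delete_crossings {e, f} L) H" by simp
    have "index H e = - index H f"
      using consecutive_height[OF c1 H] c2 consecutive_height[OF _ H, of "(e, \<not> s)" "(f, s)"]
        consecutive_height[OF _ H, of "(f, s)" "(e, \<not> s)"] by (cases s) (auto simp: index_def)
    then show "height_poly (delete_crossings {e, f} L) H = height_poly L H"
      by (intro height_poly_delete cancel) (auto simp: crossing_term_uminus)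
  qed
  ultimately show ?thesis using L is_gauss_code_delete[OF L] unfolding same_invariants_def by blast
qed

text \<open>
  Each exchange lowers its two letters by \<open>1\<close>. Together the three pairs contain both ends of each
  of the three crossings, so every index is unchanged.
\<close>

lemma same_invariants_type_III:
  assumes L: "is_gauss_code L" and xyz: "distinct [x, y, z]"
    and c1: "consecutive L (x, True) (z, False)"
    and c2: "consecutive L (y, True) (x, False)"
    and c3: "consecutive L (z, True) (y, False)"
  shows "same_invariants L
       (swap_letters (x, True) (z, False)
         (swap_letters (y, True) (x, False)
           (swap_letters (z, True) (y, False) L)))"
proof -
  define L1 where "L1 = swap_letters (z, True) (y, False) L"
  define L2 where "L2 = swap_letters (y, True) (x, False) L1"
  define L3 where "L3 = swap_letters (x, True) (z, False) L2"
  have c2': "consecutive L1 (y, True) (x, False)"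
    unfolding L1_def using xyz by (intro consecutive_swap c2) auto
  have c1': "consecutive L2 (x, True) (z, False)"
    unfolding L2_def L1_def using xyz by (intro consecutive_swap c1) auto
  have L1: "is_gauss_code L1" unfolding L1_def by (rule is_gauss_code_swap[OF c3 L])
  have L2: "is_gauss_code L2" unfolding L2_def by (rule is_gauss_code_swap[OF c2' L1])
  have L3: "is_gauss_code L3" unfolding L3_def by (rule is_gauss_code_swap[OF c1' L2])
  note d = gauss_code_distinct[OF L] gauss_code_distinct[OF L1] gauss_code_distinct[OF L2]
  have len: "length L3 = length L" and sets: "\<And>A. A < length L \<Longrightarrow> set (L3 ! A) = set (L ! A)"
    using swap_letters_eq[OF c3, folded L1_def] swap_letters_eq[OF c2', folded L2_def]
      swap_letters_eq[OF c1', folded L3_def] d by simp_all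
  have "\<exists>H'. is_height L3 H' \<and> height_poly L3 H' = height_poly L H" if H: "is_height L H" for H
  proof -
    define H1 where "H1 = (\<lambda>c. H c - of_bool (c \<in> {(z, True), (y, False)}))"
    define H2 where "H2 = (\<lambda>c. H1 c - of_bool (c \<in> {(y, True), (x, False)}))"
    define H3 where "H3 = (\<lambda>c. H2 c - of_bool (c \<in> {(x, True), (z, False)}))"
    have "is_height L1 H1" unfolding L1_def H1_def by (rule is_height_swap[OF d(1) c3 _ _ H]) simp_all
    then have "is_height L2 H2" unfolding L2_def H2_def by (intro is_height_swap[OF d(2) c2']) simp_all
    then have "is_height L3 H3" unfolding L3_def H3_def by (intro is_height_swap[OF d(3) c1']) simp_all
    moreover have "height_poly L3 H3 = height_poly L H"
    proof (rule height_poly_cong[OF len sets])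
      fix c
      have "H3 (c, s) = H (c, s) - of_bool (c \<in> {x, y, z})" for s
        using xyz by (cases s) (auto simp: H3_def H2_def H1_def)
      then show "index H3 c = index H c" by (simp add: index_def)
    qed
    ultimately show ?thesis by blast
  qed
  moreover have "balanced L3 \<longleftrightarrow> balanced L" using len sets by (rule balanced_cong)
  ultimately have "same_invariants L L3" using L L3 by (simp add: same_invariants_def)
  then show ?thesis unfolding L3_def L2_def L1_def .
qed

lemma same_invariants_flat_move: "flat_move L L' \<Longrightarrow> same_invariants L L'"
proof (induction rule: flat_move.induct)
  case (rotation L L')
  then show ?case by (rule same_invariants_rotation)
next
  case (relabelling L f)
  then show ?case by (rule same_invariants_relabelling)
next
  case (type_I L e s)
  then show ?case by (rule same_invariants_type_I)
next
  case (type_II L e f s)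
  then show ?case by (rule same_invariants_type_II)
next
  case (type_III L x y z)
  then show ?case by (rule same_invariants_type_III)
qed

lemma link_poly_eq_if_same_invariants:
  assumes "same_invariants L L'" and "balanced L" and "pairing_choice L P" and "pairing_choice L' P'"
  shows "link_poly L P = link_poly L' P'"
proof -
  have L: "is_gauss_code L" and L': "is_gauss_code L'"
    using assms(1) by (auto simp: same_invariants_def)
  obtain H where H: "is_height L H" using ex_height[OF L assms(2)] by blast
  then obtain H' where "is_height L' H'" "height_poly L' H' = height_poly L H"
    using assms(1) by (auto simp: same_invariants_def)
  then show ?thesis
    using link_poly_eq_height_poly[OF L H assms(3)] link_poly_eq_height_poly[OF L' _ assms(4)] by simp
qed

theorem theoremA:
  fixes L :: "'x gauss_code"
  assumes "is_gauss_code L" and "balanced L"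
  shows "(\<exists>P. pairing_choice L P) \<and>
         (\<forall>P Q. pairing_choice L P \<longrightarrow> pairing_choice L Q \<longrightarrow> link_poly L P = link_poly L Q) \<and>
         (\<forall>L'. flat_equivalent L L' \<longrightarrow>
            is_gauss_code L' \<and> balanced L' \<and>
            (\<forall>P P'. pairing_choice L P \<longrightarrow> pairing_choice L' P' \<longrightarrow>
               link_poly L P = link_poly L' P'))"
proof (intro conjI allI impI)
  show "\<exists>P. pairing_choice L P" using assms by (rule ex_pairing_choice)
  show indep: "link_poly L P = link_poly L Q" if "pairing_choice L P" "pairing_choice L Q" for P Q
    using that ex_height[OF assms] link_poly_eq_height_poly[OF assms(1)] by auto
  fix L' assume "flat_equivalent L L'"
  then have "equivclp flat_move L L'" by (simp add: flat_equivalent_def)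
  then have main: "is_gauss_code L' \<and> balanced L' \<and>
      (\<forall>P P'. pairing_choice L P \<longrightarrow> pairing_choice L' P' \<longrightarrow> link_poly L P = link_poly L' P')"
  proof (induction rule: equivclp_induct)
    case base
    show ?case using assms indep by blast
  next
    case (step K K')
    then have K: "is_gauss_code K" "balanced K" by auto
    have same: "same_invariants K K' \<or> same_invariants K' K"
      using step.hyps(2) same_invariants_flat_move by blast
    then have K': "is_gauss_code K'" "balanced K'"
      using K by (auto simp: same_invariants_def)
    have poly: "link_poly K P = link_poly K' P'"
      if "pairing_choice K P" "pairing_choice K' P'" for P P'
      using same
    proof
      assume "same_invariants K K'"
      then show ?thesis using K(2) that by (rule link_poly_eq_if_same_invariants)
    next
      assume "same_invariants K' K"
      then show ?thesis using K'(2) that(2,1) by (rule link_poly_eq_if_same_invariants[symmetric])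
    qed
    \<comment> \<open>The comparison of \<open>L\<close> with \<open>K'\<close> passes through some pairing of the intermediate code \<open>K\<close>.\<close>
    obtain Q where "pairing_choice K Q" using ex_pairing_choice[OF K] by blast
    then have "link_poly L P = link_poly K' P'" if "pairing_choice L P" "pairing_choice K' P'" for P P'
      using step.IH poly[of Q P'] that by auto
    then show ?case using K' by blast
  qed
  then show "is_gauss_code L'" "balanced L'" by blast+
  show "link_poly L P = link_poly L' P'" if "pairing_choice L P" "pairing_choice L' P'" for P P'
    using main that by blast
qed

end
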